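(* Let $G$ be a finite graph without multiple edges and with at most one loop at each vertex, let $n=|V(G)|$, let $m_0$ be the number of non-loop edges, $m_1$ the number of loops, and $m'=2m_0+m_1=|D(G)|$. Let $a,b:D(G)\to\mathbb{H}$ be arbitrary maps, and let $\mathbf{K},\mathbf{L},\mathbf{J}_0,\tilde{\mathbf{W}},\tilde{\mathbf{D}}$ be the quaternionic matrices built from $G,a,b$ as defined in the context. Then, for a complex variable $t$ (as an identity of rational functions in $t$), $$\det\big(\mathbf{I}_{2m'}-t\,\psi(\mathbf{K}\mathbf{L}^*-\mathbf{J}_0)\big)=(1-t^2)^{2m_0-2n}(1+t)^{2m_1}\det\big(\mathbf{I}_{2n}-t\,\psi(\tilde{\mathbf{W}})+t^2(\psi(\tilde{\mathbf{D}})-\mathbf{I}_{2n})\big).$$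
   Context: $\mathbb{H}$ denotes the real quaternions with basis $1,i,j,k$; $x^*$ is the quaternionic conjugate of $x\in\mathbb{H}$; for a quaternionic matrix $\mathbf{M}$, $\mathbf{M}^*$ is its conjugate transpose, $(\mathbf{M}^* )_{rs}=(\mathbf{M}_{sr})^*$. Every quaternionic $p\times q$ matrix can be written uniquely as $\mathbf{M}=\mathbf{A}+j\mathbf{B}$ with complex $p\times q$ matrices $\mathbf{A},\mathbf{B}$, and $$\psi(\mathbf{M})=\begin{pmatrix}\mathbf{A}&-\overline{\mathbf{B}}\\ \mathbf{B}&\overline{\mathbf{A}}\end{pmatrix},$$ a complex $2p\times 2q$ matrix. Arcs: for each unoriented edge $uv$ of $G$, the ordered pairs $(u,v)$ and $(v,u)$ are arcs; $D(G)$ is the set of all arcs. For $e=(u,v)$, $o(e)=u$ is its origin, $t(e)=v$ its terminus, $e^{-1}=(v,u)$. A loop at $u$ gives exactly one arc $(u,u)$, so $e^{-1}=e$ if and only if $e$ is a loop. Matrices: $\mathbf{J}_0$ is indexed by $D(G)\times D(G)$, with $(e,f)$ entry $1$ if $f=e^{-1}$ and $0$ otherwise. $\mathbf{K},\mathbf{L}$ are indexed by $D(G)\times V(G)$: $\mathbf{K}_{ev}=a(e)$ if $o(e)=v$ and $0$ otherwise; $\mathbf{L}_{ev}=b(e)$ if $t(e)=v$ and $0$ otherwise. $\tilde{\mathbf{W}},\tilde{\mathbf{D}}$ are indexed by $V(G)\times V(G)$: $\tilde{\mathbf{W}}_{uv}=b((v,u))^*a((v,u))$ if $(v,u)\in D(G)$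 and $0$ otherwise; $\tilde{\mathbf{D}}$ is diagonal with $\tilde{\mathbf{D}}_{uu}=\sum_{e\in D(G),\,o(e)=u}b(e^{-1})^*a(e)$. *)

theory Defs
  imports
    Complex_Main
    "HOL-Computational_Algebra.Polynomial_Factorial"
    "Jordan_Normal_Form.Determinant"
begin

section \<open>Quaternions\<close>

datatype quat = Quat (qRe: real) (qI: real) (qJ: real) (qK: real)

lemma quat_eq_iff:
  "x = y \<longleftrightarrow> qRe x = qRe y \<and> qI x = qI y \<and> qJ x = qJ y \<and> qK x = qK y"
  by (cases x; cases y) auto

instantiation quat :: ring_1
begin

definition "0 = Quat 0 0 0 0"
definition "1 = Quat 1 0 0 0"
definition "x + y = Quat (qRe x + qRe y) (qI x + qI y) (qJ x + qJ y) (qK x + qK y)"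
definition "- x = Quat (- qRe x) (- qI x) (- qJ x) (- qK x)"
definition "x - y = Quat (qRe x - qRe y) (qI x - qI y) (qJ x - qJ y) (qK x - qK y)"
definition "x * y = Quat
  (qRe x * qRe y - qI x * qI y - qJ x * qJ y - qK x * qK y)
  (qRe x * qI y + qI x * qRe y + qJ x * qK y - qK x * qJ y)
  (qRe x * qJ y - qI x * qK y + qJ x * qRe y + qK x * qI y)
  (qRe x * qK y + qI x * qJ y - qJ x * qI y + qK x * qRe y)"

lemmas quat_arith_defs =
  zero_quat_def one_quat_def plus_quat_def uminus_quat_def minus_quat_def times_quat_def

instance
  by standard (simp_all add: quat_arith_defs algebra_simps)

end

definition quat_i :: quat where "quat_i = Quat 0 1 0 0"
definition quat_j :: quat where "quat_j = Quat 0 0 1 0"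
definition quat_k :: quat where "quat_k = Quat 0 0 0 1"

lemma quat_units:
  "quat_i * quat_i = -1" "quat_j * quat_j = -1" "quat_k * quat_k = -1"
  "quat_i * quat_j = quat_k" "quat_j * quat_k = quat_i" "quat_k * quat_i = quat_j"
  "quat_j * quat_i = - quat_k" "quat_k * quat_j = - quat_i" "quat_i * quat_k = - quat_j"
  by (simp_all add: quat_i_def quat_j_def quat_k_def quat_arith_defs)

definition quat_conj :: "quat \<Rightarrow> quat" where
  "quat_conj x = Quat (qRe x) (- qI x) (- qJ x) (- qK x)"

definition quat_of_complex :: "complex \<Rightarrow> quat" where
  "quat_of_complex z = Quat (Re z) (Im z) 0 0"

text \<open>
  The components of \<open>x = \<alpha> + j \<beta>\<close> with complex \<open>\<alpha>\<close>, \<open>\<beta>\<close>. As \<open>j\<close> stands on the left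
  and \<open>j i = - k\<close>, the \<open>k\<close>-coordinate enters \<open>\<beta>\<close> with a minus sign.
\<close>

definition cpart :: "quat \<Rightarrow> complex" where
  "cpart x = Complex (qRe x) (qI x)"

definition jpart :: "quat \<Rightarrow> complex" where
  "jpart x = Complex (qJ x) (- qK x)"

lemma quat_decomp_iff:
  "x = quat_of_complex \<alpha> + quat_j * quat_of_complex \<beta> \<longleftrightarrow> \<alpha> = cpart x \<and> \<beta> = jpart x"
  by (auto simp: quat_eq_iff complex_eq_iff quat_of_complex_def quat_j_def cpart_def jpart_def
      quat_arith_defs)


section \<open>Quaternionic matrices\<close>

definition conj_transpose :: "quat mat \<Rightarrow> quat mat" where
  "conj_transpose M = map_mat quat_conj (transpose_mat M)"

definition psi :: "quat mat \<Rightarrow> complex mat" where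
  "psi M = (let A = map_mat cpart M; B = map_mat jpart M in
     four_block_mat A (- map_mat cnj B) B (map_mat cnj A))"

lemma quat_mat_decomp_iff:
  assumes "M \<in> carrier_mat p q" "A \<in> carrier_mat p q" "B \<in> carrier_mat p q"
  shows "M = map_mat quat_of_complex A + quat_j \<cdot>\<^sub>m map_mat quat_of_complex B \<longleftrightarrow>
    A = map_mat cpart M \<and> B = map_mat jpart M"
  using assms by (auto simp: mat_eq_iff quat_decomp_iff)

lemma psi_carrier: "M \<in> carrier_mat p q \<Longrightarrow> psi M \<in> carrier_mat (2 * p) (2 * q)"
  by (auto simp: psi_def Let_def)


section \<open>Graphs and their arcs\<close>

text \<open>
  A graph without multiple edges is given by its vertex set and its set of unoriented edges
  \<open>{u, v}\<close>; a loop at \<open>u\<close> is the singleton \<open>{u}\<close>.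
\<close>

definition finite_loop_graph :: "'v set \<Rightarrow> 'v set set \<Rightarrow> bool" where
  "finite_loop_graph V E \<longleftrightarrow> finite V \<and> (\<forall>e\<in>E. \<exists>u\<in>V. \<exists>v\<in>V. e = {u, v})"

definition loop_edges :: "'v set set \<Rightarrow> 'v set set" where
  "loop_edges E = {e \<in> E. \<exists>u. e = {u}}"

definition nonloop_edges :: "'v set set \<Rightarrow> 'v set set" where
  "nonloop_edges E = {e \<in> E. \<exists>u v. u \<noteq> v \<and> e = {u, v}}"

definition arcs :: "'v set set \<Rightarrow> ('v \<times> 'v) set" where
  "arcs E = {(u, v). {u, v} \<in> E}"

abbreviation origin :: "'v \<times> 'v \<Rightarrow> 'v" where "origin \<equiv> fst"
abbreviation terminus :: "'v \<times> 'v \<Rightarrow> 'v" where "terminus \<equiv> snd"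
abbreviation arc_inv :: "'v \<times> 'v \<Rightarrow> 'v \<times> 'v" where "arc_inv \<equiv> prod.swap"

lemma card_arcs:
  assumes "finite_loop_graph V E"
  shows "card (arcs E) = 2 * card (nonloop_edges E) + card (loop_edges E)"
proof -
  have fV: "finite V" and E: "\<And>e. e \<in> E \<Longrightarrow> \<exists>u\<in>V. \<exists>v\<in>V. e = {u, v}"
    using assms by (auto simp: finite_loop_graph_def)
  have fE: "finite E"
  proof (rule finite_subset)
    show "E \<subseteq> Pow V" using E by blast
  qed (use fV in simp)
  let ?A = "\<lambda>e. {(u, v). {u, v} = e}"
  have "e \<in> nonloop_edges E \<union> loop_edges E" if e: "e \<in> E" for e
  proof -
    obtain u v where "e = {u, v}" using E[OF e] by blast
    then show ?thesis
      using e by (cases "u = v") (auto simp: nonloop_edges_def loop_edges_def)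
  qed
  then have un: "nonloop_edges E \<union> loop_edges E = E"
    by (auto simp: nonloop_edges_def loop_edges_def)
  have disj: "nonloop_edges E \<inter> loop_edges E = {}"
    by (auto simp: nonloop_edges_def loop_edges_def doubleton_eq_iff)
  have fin: "finite (nonloop_edges E)" "finite (loop_edges E)"
    using fE by (auto simp: nonloop_edges_def loop_edges_def)
  have nl: "finite (?A e) \<and> card (?A e) = 2" if e: "e \<in> nonloop_edges E" for e
  proof -
    obtain u v where uv: "u \<noteq> v" "e = {u, v}"
      using e unfolding nonloop_edges_def by blast
    have "?A e = {(u, v), (v, u)}"
      unfolding uv by (auto simp: doubleton_eq_iff)
    then show ?thesis using uv by simp
  qed
  have l: "finite (?A e) \<and> card (?A e) = 1" if e: "e \<in> loop_edges E" for e
  proof -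
    obtain u where u: "e = {u}"
      using e unfolding loop_edges_def by blast
    have "?A e = {(u, u)}"
      unfolding u by auto
    then show ?thesis by simp
  qed
  have "arcs E = (\<Union>e\<in>E. ?A e)"
    by (auto simp: arcs_def)
  also have "card \<dots> = (\<Sum>e\<in>E. card (?A e))"
  proof (rule card_UN_disjoint)
    show "\<forall>e\<in>E. finite (?A e)"
      using nl l by (subst un[symmetric]) blast
  qed (use fE in auto)
  also have "\<dots> = (\<Sum>e\<in>nonloop_edges E. card (?A e)) + (\<Sum>e\<in>loop_edges E. card (?A e))"
    using sum.union_disjoint[OF fin disj, of "\<lambda>e. card (?A e)"] by (simp only: un)
  also have "\<dots> = 2 * card (nonloop_edges E) + card (loop_edges E)"
    using nl l by simp
  finally show ?thesis .
qed


section \<open>The matrices attached to a weighted graph\<close>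

text \<open>
  Matrices indexed by finite sets are written out along enumerations of the index sets: below,
  \<open>vs\<close> enumerates the vertices and \<open>es\<close> the arcs.
\<close>

definition indexed_mat :: "'i list \<Rightarrow> 'j list \<Rightarrow> ('i \<Rightarrow> 'j \<Rightarrow> 'a) \<Rightarrow> 'a mat" where
  "indexed_mat xs ys f = mat (length xs) (length ys) (\<lambda>(r, s). f (xs ! r) (ys ! s))"

definition J0_mat :: "('v \<times> 'v) list \<Rightarrow> quat mat" where
  "J0_mat es = indexed_mat es es (\<lambda>e f. if f = arc_inv e then 1 else 0)"

definition K_mat :: "('v \<times> 'v) list \<Rightarrow> 'v list \<Rightarrow> ('v \<times> 'v \<Rightarrow> quat) \<Rightarrow> quat mat" where
  "K_mat es vs a = indexed_mat es vs (\<lambda>e v. if origin e = v then a e else 0)"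

definition L_mat :: "('v \<times> 'v) list \<Rightarrow> 'v list \<Rightarrow> ('v \<times> 'v \<Rightarrow> quat) \<Rightarrow> quat mat" where
  "L_mat es vs b = indexed_mat es vs (\<lambda>e v. if terminus e = v then b e else 0)"

definition W_mat ::
    "'v set set \<Rightarrow> 'v list \<Rightarrow> ('v \<times> 'v \<Rightarrow> quat) \<Rightarrow> ('v \<times> 'v \<Rightarrow> quat) \<Rightarrow> quat mat" where
  "W_mat E vs a b = indexed_mat vs vs
     (\<lambda>u v. if (v, u) \<in> arcs E then quat_conj (b (v, u)) * a (v, u) else 0)"

definition D_mat ::
    "'v set set \<Rightarrow> 'v list \<Rightarrow> ('v \<times> 'v \<Rightarrow> quat) \<Rightarrow> ('v \<times> 'v \<Rightarrow> quat) \<Rightarrow> quat mat" where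
  "D_mat E vs a b = indexed_mat vs vs
     (\<lambda>u v. if u = v then \<Sum>e\<in>{e \<in> arcs E. origin e = u}. quat_conj (b (arc_inv e)) * a e else 0)"


section \<open>Rational functions in one complex variable\<close>

type_synonym ratfun = "complex poly fract"

definition ratfun_var :: ratfun where
  "ratfun_var = to_fract [:0, 1:]"

definition ratfun_const :: "complex \<Rightarrow> ratfun" where
  "ratfun_const c = to_fract [:c:]"

abbreviation const_mat :: "complex mat \<Rightarrow> ratfun mat" where
  "const_mat \<equiv> map_mat ratfun_const"

end

theory Submission
  imports Defs
begin

text \<open>
  Since \<open>\<psi>\<close> is multiplicative, \<open>\<psi>(L\<^sup>*) \<psi>(K) = \<psi>(W)\<close>,
  \<open>\<psi>(L\<^sup>*) \<psi>(J\<^sub>0) \<psi>(K) = \<psi>(D)\<close> and \<open>N = \<psi>(J\<^sub>0)\<close> is an involution. As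
  \<open>(1 + t N) (1 - t N) = 1 - t\<^sup>2\<close>, two block factorizations exchanging the factors \<open>K\<close> and
  \<open>L\<^sup>*\<close> express the left-hand determinant, times \<open>(1 - t\<^sup>2)\<close> to the power \<open>2 n\<close>, as
  \<open>det (1 + t N)\<close> times the right-hand one. The matrix \<open>\<psi>(J\<^sub>0)\<close> consists of two diagonal copies
  of the permutation matrix of arc inversion, and each pair of inverse arcs contributes
  \<open>1 - t\<^sup>2\<close> and each loop \<open>1 + t\<close> to the determinant of either copy.
\<close>

section \<open>Determinants\<close>

text \<open>The determinant of one block matrix with diagonal blocks \<open>1 + t N\<close> and
  \<open>1\<close> is computed by eliminating either off-diagonal block. The inverse of
  \<open>1 + t N\<close> would be \<open>(1 - t N) / (1 - t^2)\<close>; keeping the power of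
  \<open>1 - t^2\<close> on the left clears this denominator, so the identity makes sense in any
  integral domain.\<close>

lemma det_one_minus_mult_involution:
  fixes A B N :: "'a :: idom mat"
  assumes A: "A \<in> carrier_mat m k" and B: "B \<in> carrier_mat k m" and N: "N \<in> carrier_mat m m"
    and inv: "N * N = 1\<^sub>m m"
  shows "det (1\<^sub>m m - t \<cdot>\<^sub>m (A * B - N)) * (1 - t\<^sup>2) ^ k =
    det (1\<^sub>m m + t \<cdot>\<^sub>m N) *
    det (1\<^sub>m k - t \<cdot>\<^sub>m (B * A) + t\<^sup>2 \<cdot>\<^sub>m (B * (N * A) - 1\<^sub>m k))"
proof -
  let ?X = "1\<^sub>m m + t \<cdot>\<^sub>m N" and ?Y = "1\<^sub>m m - t \<cdot>\<^sub>m N"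
  \<comment> \<open>Both \<open>?P\<close> and \<open>?Q\<close> triangulate \<open>?M\<close>; \<open>?Q\<close> does so because \<open>?X * ?Y = 1 - t\<^sup>2\<close>.\<close>
  let ?M = "four_block_mat ?X A (t \<cdot>\<^sub>m B) (1\<^sub>m k)"
  let ?P = "four_block_mat (1\<^sub>m m) (0\<^sub>m m k) (- (t \<cdot>\<^sub>m B)) (1\<^sub>m k)"
  let ?Q = "four_block_mat (1\<^sub>m m) (- (?Y * A)) (0\<^sub>m k m) ((1 - t\<^sup>2) \<cdot>\<^sub>m 1\<^sub>m k)"
  have X: "?X \<in> carrier_mat m m"
    and tB: "t \<cdot>\<^sub>m B \<in> carrier_mat k m" and YA: "?Y * A \<in> carrier_mat m k"
    using A B N by auto
  have NA: "N * A \<in> carrier_mat m k" and BA: "B * A \<in> carrier_mat k k"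
    and BNA: "B * (N * A) \<in> carrier_mat k k" and AB: "A * B \<in> carrier_mat m m"
    using A B N by auto
  have NNA: "N * (N * A) = A"
    using assoc_mult_mat[OF N N A] inv A by simp
  have YA_eq: "?Y * A = A - t \<cdot>\<^sub>m (N * A)"
    using minus_mult_distrib_mat[of "1\<^sub>m m" m m "t \<cdot>\<^sub>m N" A k] mult_smult_assoc_mat[OF N A] A N
    by simp
  \<comment> \<open>This identity and the next three are stated for variable matrices
    \<open>C\<close> and \<open>D\<close> in place of products, so that the entrywise proofs meet no
    scalar products.\<close>
  have X_combine: "A - t \<cdot>\<^sub>m C + t \<cdot>\<^sub>m (C - t \<cdot>\<^sub>m A) = (1 - t\<^sup>2) \<cdot>\<^sub>m A"
    if "C \<in> carrier_mat m k" for C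
    using A that by (intro eq_matI) (auto simp: algebra_simps power2_eq_square)
  have smult_diff: "t \<cdot>\<^sub>m (C - t \<cdot>\<^sub>m D) = t \<cdot>\<^sub>m C - t\<^sup>2 \<cdot>\<^sub>m D"
    if "C \<in> carrier_mat k k" "D \<in> carrier_mat k k" for C D
    using that by (intro eq_matI) (auto simp: algebra_simps power2_eq_square)
  have N_combine: "1\<^sub>m m + t \<cdot>\<^sub>m N + - (t \<cdot>\<^sub>m C) = 1\<^sub>m m - t \<cdot>\<^sub>m (C - N)"
    if "C \<in> carrier_mat m m" for C
    using N that by (intro eq_matI) (auto simp: algebra_simps)
  have D_combine: "- (t \<cdot>\<^sub>m C - t\<^sup>2 \<cdot>\<^sub>m D) + (1 - t\<^sup>2) \<cdot>\<^sub>m 1\<^sub>m k =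
      1\<^sub>m k - t \<cdot>\<^sub>m C + t\<^sup>2 \<cdot>\<^sub>m (D - 1\<^sub>m k)"
    if "C \<in> carrier_mat k k" "D \<in> carrier_mat k k" for C D
    using that by (intro eq_matI) (auto simp: algebra_simps)
  have XYA: "?X * (?Y * A) = (1 - t\<^sup>2) \<cdot>\<^sub>m A"
  proof -
    have "?X * (?Y * A) = ?Y * A + t \<cdot>\<^sub>m (N * (?Y * A))"
      using add_mult_distrib_mat[of "1\<^sub>m m" m m "t \<cdot>\<^sub>m N" "?Y * A" k]
        mult_smult_assoc_mat[OF N YA] N YA by simp
    also have "N * (?Y * A) = N * A - t \<cdot>\<^sub>m A"
      unfolding YA_eq using mult_minus_distrib_mat[OF N A, of "t \<cdot>\<^sub>m (N * A)"]
        mult_smult_distrib[OF N NA] NNA NA by simp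
    also have "?Y * A + t \<cdot>\<^sub>m (N * A - t \<cdot>\<^sub>m A) = (1 - t\<^sup>2) \<cdot>\<^sub>m A"
      unfolding YA_eq by (rule X_combine[OF NA])
    finally show ?thesis .
  qed
  have BYA: "t \<cdot>\<^sub>m B * (?Y * A) = t \<cdot>\<^sub>m (B * A) - t\<^sup>2 \<cdot>\<^sub>m (B * (N * A))"
  proof -
    have "t \<cdot>\<^sub>m B * (?Y * A) = t \<cdot>\<^sub>m (B * (A - t \<cdot>\<^sub>m (N * A)))"
      using mult_smult_assoc_mat[OF B YA] YA_eq by simp
    also have "B * (A - t \<cdot>\<^sub>m (N * A)) = B * A - t \<cdot>\<^sub>m (B * (N * A))"
      using mult_minus_distrib_mat[OF B A, of "t \<cdot>\<^sub>m (N * A)"] mult_smult_distrib[OF B NA] NA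
      by simp
    finally show ?thesis
      using smult_diff[OF BA BNA] by simp
  qed
  have M: "?M \<in> carrier_mat (m + k) (m + k)" and P: "?P \<in> carrier_mat (m + k) (m + k)"
    and Q: "?Q \<in> carrier_mat (m + k) (m + k)"
    using X by auto
  have "?M * ?P = four_block_mat (?X * 1\<^sub>m m + A * - (t \<cdot>\<^sub>m B)) (?X * 0\<^sub>m m k + A * 1\<^sub>m k)
      (t \<cdot>\<^sub>m B * 1\<^sub>m m + 1\<^sub>m k * - (t \<cdot>\<^sub>m B)) (t \<cdot>\<^sub>m B * 0\<^sub>m m k + 1\<^sub>m k * 1\<^sub>m k)"
    by (rule mult_four_block_mat[OF X A tB one_carrier_mat one_carrier_mat zero_carrier_mat
          uminus_carrier_mat[OF tB] one_carrier_mat])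
  also have "A * - (t \<cdot>\<^sub>m B) = - (t \<cdot>\<^sub>m (A * B))"
    using mult_smult_distrib[OF A B] uminus_mult_right_mat[of A "t \<cdot>\<^sub>m B"] A B by simp
  also have "?X * 1\<^sub>m m + - (t \<cdot>\<^sub>m (A * B)) = 1\<^sub>m m - t \<cdot>\<^sub>m (A * B - N)"
    unfolding right_mult_one_mat[OF X] by (rule N_combine[OF AB])
  also have "?X * 0\<^sub>m m k + A * 1\<^sub>m k = A"
    unfolding right_mult_zero_mat[OF X] using A by simp
  also have "t \<cdot>\<^sub>m B * 1\<^sub>m m + 1\<^sub>m k * - (t \<cdot>\<^sub>m B) = 0\<^sub>m k m"
    unfolding right_mult_one_mat[OF tB] left_mult_one_mat[OF uminus_carrier_mat[OF tB]]
    using B by (intro eq_matI) auto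
  also have "t \<cdot>\<^sub>m B * 0\<^sub>m m k + 1\<^sub>m k * 1\<^sub>m k = 1\<^sub>m k"
    unfolding right_mult_zero_mat[OF tB] by simp
  finally have MP: "?M * ?P = four_block_mat (1\<^sub>m m - t \<cdot>\<^sub>m (A * B - N)) A (0\<^sub>m k m) (1\<^sub>m k)" .
  have "det (?M * ?P) = det (1\<^sub>m m - t \<cdot>\<^sub>m (A * B - N)) * det (1\<^sub>m k :: 'a mat)"
    unfolding MP
    by (rule det_four_block_mat_lower_left_zero[OF _ A refl one_carrier_mat])
      (intro minus_carrier_mat smult_carrier_mat N)
  moreover have "det ?P = det (1\<^sub>m m :: 'a mat) * det (1\<^sub>m k :: 'a mat)"
    by (rule det_four_block_mat_upper_right_zero[OF one_carrier_mat refl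
          uminus_carrier_mat[OF tB] one_carrier_mat])
  ultimately have detM: "det ?M = det (1\<^sub>m m - t \<cdot>\<^sub>m (A * B - N))"
    using det_mult[OF M P] by simp
  let ?S = "(1 - t\<^sup>2) \<cdot>\<^sub>m 1\<^sub>m k :: 'a mat"
  have "?M * ?Q = four_block_mat (?X * 1\<^sub>m m + A * 0\<^sub>m k m) (?X * - (?Y * A) + A * ?S)
      (t \<cdot>\<^sub>m B * 1\<^sub>m m + 1\<^sub>m k * 0\<^sub>m k m) (t \<cdot>\<^sub>m B * - (?Y * A) + 1\<^sub>m k * ?S)"
    by (rule mult_four_block_mat[OF X A tB one_carrier_mat one_carrier_mat
          uminus_carrier_mat[OF YA] zero_carrier_mat smult_carrier_mat[OF one_carrier_mat]])
  also have "?X * 1\<^sub>m m + A * 0\<^sub>m k m = ?X"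
    unfolding right_mult_one_mat[OF X] right_mult_zero_mat[OF A] by (rule right_add_zero_mat[OF X])
  also have "?X * - (?Y * A) = - ((1 - t\<^sup>2) \<cdot>\<^sub>m A)"
    using uminus_mult_right_mat[of ?X "?Y * A"] carrier_matD(2)[OF X] carrier_matD(1)[OF YA] XYA
    by metis
  also have "A * ?S = (1 - t\<^sup>2) \<cdot>\<^sub>m A"
    using mult_smult_distrib[OF A one_carrier_mat] A by simp
  also have "- ((1 - t\<^sup>2) \<cdot>\<^sub>m A) + (1 - t\<^sup>2) \<cdot>\<^sub>m A = 0\<^sub>m m k"
    using A by (intro eq_matI) auto
  also have "t \<cdot>\<^sub>m B * 1\<^sub>m m + 1\<^sub>m k * 0\<^sub>m k m = t \<cdot>\<^sub>m B"
    unfolding right_mult_one_mat[OF tB] using tB by simp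
  also have "t \<cdot>\<^sub>m B * - (?Y * A) = - (t \<cdot>\<^sub>m (B * A) - t\<^sup>2 \<cdot>\<^sub>m (B * (N * A)))"
    using uminus_mult_right_mat[of "t \<cdot>\<^sub>m B" "?Y * A"] carrier_matD(2)[OF tB]
      carrier_matD(1)[OF YA] BYA
    by metis
  also have "- (t \<cdot>\<^sub>m (B * A) - t\<^sup>2 \<cdot>\<^sub>m (B * (N * A))) + 1\<^sub>m k * ?S =
      1\<^sub>m k - t \<cdot>\<^sub>m (B * A) + t\<^sup>2 \<cdot>\<^sub>m (B * (N * A) - 1\<^sub>m k)"
    unfolding left_mult_one_mat[OF smult_carrier_mat[OF one_carrier_mat]]
    by (rule D_combine[OF BA BNA])
  finally have MQ: "?M * ?Q = four_block_mat ?X (0\<^sub>m m k) (t \<cdot>\<^sub>m B)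
      (1\<^sub>m k - t \<cdot>\<^sub>m (B * A) + t\<^sup>2 \<cdot>\<^sub>m (B * (N * A) - 1\<^sub>m k))" .
  have "det (?M * ?Q) = det ?X *
      det (1\<^sub>m k - t \<cdot>\<^sub>m (B * A) + t\<^sup>2 \<cdot>\<^sub>m (B * (N * A) - 1\<^sub>m k))"
    unfolding MQ
    by (rule det_four_block_mat_upper_right_zero[OF X refl tB])
      (intro add_carrier_mat minus_carrier_mat smult_carrier_mat one_carrier_mat)
  moreover have "det ?Q = det (1\<^sub>m m :: 'a mat) * det ?S"
    by (rule det_four_block_mat_lower_left_zero[OF one_carrier_mat
          uminus_carrier_mat[OF YA] refl smult_carrier_mat[OF one_carrier_mat]])
  ultimately show ?thesis
    using det_mult[OF M Q] detM by simp
qed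

section \<open>Matrices along enumerations of finite index sets\<close>

lemma indexed_mat_carrier [simp]:
  "indexed_mat xs ys f \<in> carrier_mat (length xs) (length ys)"
  by (simp add: indexed_mat_def)

lemma indexed_mat_cong:
  assumes "\<And>x y. x \<in> set xs \<Longrightarrow> y \<in> set ys \<Longrightarrow> f x y = g x y"
  shows "indexed_mat xs ys f = indexed_mat xs ys g"
  using assms by (auto simp: indexed_mat_def intro!: eq_matI)

lemma map_indexed_mat:
  "map_mat h (indexed_mat xs ys f) = indexed_mat xs ys (\<lambda>x y. h (f x y))"
  by (auto simp: indexed_mat_def intro!: eq_matI)

lemma one_indexed_mat:
  "distinct xs \<Longrightarrow> 1\<^sub>m (length xs) = indexed_mat xs xs (\<lambda>x y. if x = y then 1 else 0)"
  by (auto simp: indexed_mat_def nth_eq_iff_index_eq intro!: eq_matI)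

text \<open>Distinctness matches the positions of \<open>ys\<close> bijectively with its elements,
  so the sum over positions becomes a sum over the index set.\<close>

lemma mult_indexed_mat:
  fixes f :: "'i \<Rightarrow> 'j \<Rightarrow> 'a :: semiring_0"
  assumes "distinct ys"
  shows "indexed_mat xs ys f * indexed_mat ys zs g =
    indexed_mat xs zs (\<lambda>x z. \<Sum>y\<in>set ys. f x y * g y z)"
proof -
  have "(\<Sum>k = 0..<length ys. h (ys ! k)) = sum h (set ys)" for h :: "'j \<Rightarrow> 'a"
    using sum.reindex_bij_betw[OF bij_betw_nth[OF assms refl refl], of h]
    by (simp add: atLeast0LessThan)
  then show ?thesis
    by (auto simp: indexed_mat_def scalar_prod_def intro!: eq_matI)
qed

text \<open>Changing the enumeration permutes rows and columns by the same permutation, so its sign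
  enters twice and cancels.\<close>

lemma det_indexed_mat_mset_eq:
  fixes f :: "'i \<Rightarrow> 'i \<Rightarrow> 'a :: comm_ring_1"
  assumes "mset xs = mset ys"
  shows "det (indexed_mat xs xs f) = det (indexed_mat ys ys f)"
proof -
  obtain p where p: "p permutes {..<length ys}" and xs: "permute_list p ys = xs"
    using mset_eq_permutation[OF assms] .
  let ?n = "length ys"
  let ?A = "indexed_mat ys ys f"
  \<comment> \<open>\<open>?R\<close> has only the rows of \<open>?A\<close> permuted. Transposition
    turns the remaining column permutation into a second row permutation.\<close>
  let ?R = "mat ?n ?n (\<lambda>(i, j). ?A $$ (p i, j))"
  have p': "p permutes {0..<?n}" using p by (simp add: atLeast0LessThan)
  have pl: "p i < ?n" if "i < ?n" for i
    using permutes_in_image[OF p, of i] that by simp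
  have len: "length xs = ?n" using xs by auto
  have nth: "xs ! i = ys ! p i" if "i < ?n" for i
    using permute_list_nth[OF p that] xs by simp
  have "transpose_mat (indexed_mat xs xs f) =
      mat ?n ?n (\<lambda>(i, j). transpose_mat ?R $$ (p i, j))"
    by (intro eq_matI) (auto simp: indexed_mat_def len nth pl)
  then have "det (indexed_mat xs xs f) = signof p * det (transpose_mat ?R)"
    using det_permute_rows[OF _ p', of "transpose_mat ?R"]
      det_transpose[of "indexed_mat xs xs f" "length xs"] by simp
  also have "det (transpose_mat ?R) = signof p * det ?A"
    using det_transpose[of ?R ?n] det_permute_rows[OF indexed_mat_carrier[of ys ys f] p'] by simp
  also have "signof p * (signof p * det ?A) = det ?A"
    by (simp add: sign_def)
  finally show ?thesis .
qed

text \<open>The vanishing entries form the lower left block, so the matrix is block triangular. This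
  serves to split off one orbit of an involution.\<close>

lemma det_indexed_mat_append:
  fixes f :: "'i \<Rightarrow> 'i \<Rightarrow> 'a :: idom"
  assumes "\<And>x y. x \<in> set xs \<Longrightarrow> y \<in> set ys \<Longrightarrow> f y x = 0"
  shows "det (indexed_mat (xs @ ys) (xs @ ys) f) =
    det (indexed_mat xs xs f) * det (indexed_mat ys ys f)"
proof -
  have "indexed_mat (xs @ ys) (xs @ ys) f =
    four_block_mat (indexed_mat xs xs f) (indexed_mat xs ys f)
      (0\<^sub>m (length ys) (length xs)) (indexed_mat ys ys f)"
    using assms by (intro eq_matI) (auto simp: indexed_mat_def nth_append)
  then show ?thesis
    using det_four_block_mat_lower_left_zero[OF indexed_mat_carrier indexed_mat_carrier refl
        indexed_mat_carrier]
    by simp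
qed

text \<open>The matrix is \<open>1 + t S\<close> with \<open>S\<close> the permutation matrix of
  \<open>s\<close>, and the determinant is a product over the orbits of \<open>s\<close>. Each
  induction step splits off the orbit of the first element; its partner may stand anywhere in the
  tail, so the induction is on the length. The halving is exact, since the non-fixed points come in
  pairs.\<close>

lemma det_one_plus_involution:
  fixes t :: "'a :: idom" and s :: "'i \<Rightarrow> 'i"
  assumes "distinct xs" and "\<And>x. x \<in> set xs \<Longrightarrow> s x \<in> set xs"
    and "\<And>x. x \<in> set xs \<Longrightarrow> s (s x) = x"
  shows "det (indexed_mat xs xs (\<lambda>x y. (if x = y then 1 else 0) + (if y = s x then t else 0))) =
    (1 - t\<^sup>2) ^ (card {x \<in> set xs. s x \<noteq> x} div 2) * (1 + t) ^ card {x \<in> set xs. s x = x}"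
  using assms
proof (induction "length xs" arbitrary: xs rule: less_induct)
  case less
  let ?f = "\<lambda>x y. (if x = y then 1 else 0) + (if y = s x then t else 0)"
  note closed = less.prems(2) and invol = less.prems(3)
  show ?case
  proof (cases xs)
    case Nil
    then show ?thesis by (simp add: indexed_mat_def)
  next
    case (Cons x zs)
    have x: "x \<in> set xs" using Cons by simp
    \<comment> \<open>\<open>?O\<close> enumerates the orbit of \<open>x\<close>, and
      \<open>ys\<close> is the rest of the index set.\<close>
    let ?O = "if s x = x then [x] else [x, s x]"
    define ys where "ys = filter (\<lambda>y. y \<notin> set ?O) xs"
    have set_ys: "set ys = set xs - {x, s x}" and dys: "distinct ys"
      using less.prems(1) by (auto simp: ys_def)
    have set_O: "set ?O = {x, s x}" and dO: "distinct ?O" by auto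
    have disj: "set ?O \<inter> set ys = {}" using set_O set_ys by auto
    have set_xs: "set (?O @ ys) = set xs"
      using set_ys x closed[OF x] by auto
    have mset: "mset xs = mset (?O @ ys)"
      using less.prems(1) dys dO disj set_xs by (intro set_eq_iff_mset_eq_distinct[THEN iffD1]) auto
    have len: "length ys < length xs"
      using mset_eq_length[OF mset] by simp
    \<comment> \<open>If \<open>s y\<close> lay in the orbit of \<open>x\<close>, then so would
      \<open>y = s (s y)\<close>.\<close>
    have closed_ys: "s y \<in> set ys" if "y \<in> set ys" for y
      using that closed[of y] invol[of y] invol[OF x] unfolding set_ys by auto
    have invol_ys: "s (s y) = y" if "y \<in> set ys" for y
      using that invol set_ys by auto
    have "det (indexed_mat xs xs ?f) = det (indexed_mat (?O @ ys) (?O @ ys) ?f)"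
      by (rule det_indexed_mat_mset_eq[OF mset])
    also have "\<dots> = det (indexed_mat ?O ?O ?f) * det (indexed_mat ys ys ?f)"
    proof (rule det_indexed_mat_append)
      fix z y assume zy: "z \<in> set ?O" "y \<in> set ys"
      then have "y \<noteq> z" "s y \<noteq> z" using disj closed_ys by auto
      then show "?f y z = 0" by simp
    qed
    also have "det (indexed_mat ys ys ?f) =
        (1 - t\<^sup>2) ^ (card {x \<in> set ys. s x \<noteq> x} div 2) * (1 + t) ^ card {x \<in> set ys. s x = x}"
      by (rule less.hyps[OF len dys closed_ys invol_ys])
    finally have det: "det (indexed_mat xs xs ?f) = det (indexed_mat ?O ?O ?f) * \<dots>" .
    show ?thesis
    proof (cases "s x = x")
      case True
      have "{y \<in> set xs. s y = y} = insert x {y \<in> set ys. s y = y}"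
        "{y \<in> set xs. s y \<noteq> y} = {y \<in> set ys. s y \<noteq> y}"
        using True x set_ys by auto
      moreover have "det (indexed_mat [x] [x] ?f) = 1 + t"
        using True by (subst det_single) (auto simp: indexed_mat_def)
      ultimately show ?thesis
        using det True set_ys by (simp add: mult_ac)
    next
      case False
      have ssx: "s (s x) \<noteq> s x" using False invol[OF x] by simp
      have "{y \<in> set xs. s y \<noteq> y} = insert x (insert (s x) {y \<in> set ys. s y \<noteq> y})"
        unfolding set_ys using False ssx x closed[OF x] by blast
      moreover have "{y \<in> set xs. s y = y} = {y \<in> set ys. s y = y}"
        unfolding set_ys using False ssx by blast
      ultimately have cards:
        "card {y \<in> set xs. s y \<noteq> y} div 2 = Suc (card {y \<in> set ys. s y \<noteq> y} div 2)"
        "card {y \<in> set xs. s y = y} = card {y \<in> set ys. s y = y}"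
        using set_ys False by auto
      have "indexed_mat [x, s x] [x, s x] ?f =
          four_block_mat (1\<^sub>m 1) (t \<cdot>\<^sub>m 1\<^sub>m 1) (t \<cdot>\<^sub>m 1\<^sub>m 1) (1\<^sub>m 1)"
        using False invol[OF x]
        by (intro eq_matI) (auto simp: indexed_mat_def nth_Cons' less_2_cases_iff)
      \<comment> \<open>Blocks of size 1 commute, so the determinant of the block matrix is that of
        the difference of the two products of blocks.\<close>
      then have "det (indexed_mat [x, s x] [x, s x] ?f) =
          det (1\<^sub>m 1 * 1\<^sub>m 1 - (t \<cdot>\<^sub>m 1\<^sub>m 1) * (t \<cdot>\<^sub>m 1\<^sub>m 1) :: 'a mat)"
        by (simp only:) (rule det_four_block_mat, auto)
      also have "\<dots> = 1 - t\<^sup>2"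
        by (subst det_single) (auto simp: scalar_prod_def power2_eq_square)
      finally show ?thesis
        using det False cards by (simp add: mult_ac)
    qed
  qed
qed

section \<open>The complex representation of quaternionic matrices\<close>

text \<open>The product rules here and for \<open>jpart\<close> come from
  \<open>z j = j (cnj z)\<close> for complex \<open>z\<close> together with \<open>j j = -1\<close>:
  moving \<open>j\<close> to the left conjugates the complex factor it passes.\<close>

lemma cpart_simps [simp]:
  "cpart 0 = 0" "cpart 1 = 1" "cpart (x + y) = cpart x + cpart y"
  "cpart (x - y) = cpart x - cpart y"
  "cpart (x * y) = cpart x * cpart y - cnj (jpart x) * jpart y"
  by (simp_all add: cpart_def jpart_def complex_eq_iff quat_arith_defs algebra_simps)

lemma jpart_simps [simp]:
  "jpart 0 = 0" "jpart 1 = 0" "jpart (x + y) = jpart x + jpart y"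
  "jpart (x - y) = jpart x - jpart y"
  "jpart (x * y) = jpart x * cpart y + cnj (cpart x) * jpart y"
  by (simp_all add: cpart_def jpart_def complex_eq_iff quat_arith_defs algebra_simps)

lemma cpart_sum: "cpart (sum f A) = (\<Sum>x\<in>A. cpart (f x))"
  by (induction A rule: infinite_finite_induct) auto

lemma jpart_sum: "jpart (sum f A) = (\<Sum>x\<in>A. jpart (f x))"
  by (induction A rule: infinite_finite_induct) auto

text \<open>\<open>psi M\<close> is the matrix of left multiplication by \<open>M\<close> on
  quaternionic columns, viewed as a right complex vector space with coordinates \<open>cpart\<close>
  and \<open>jpart\<close>; composition of maps becomes multiplication. The proof compares the four
  blocks by means of the product rules of the two parts.\<close>

lemma psi_mult:
  assumes M: "M \<in> carrier_mat p q" and N: "N \<in> carrier_mat q r"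
  shows "psi (M * N) = psi M * psi N"
proof -
  let ?A = "map_mat cpart M" and ?B = "map_mat jpart M"
  let ?C = "map_mat cpart N" and ?D = "map_mat jpart N"
  have "psi M * psi N = four_block_mat
      (?A * ?C + - map_mat cnj ?B * ?D) (?A * - map_mat cnj ?D + - map_mat cnj ?B * map_mat cnj ?C)
      (?B * ?C + map_mat cnj ?A * ?D) (?B * - map_mat cnj ?D + map_mat cnj ?A * map_mat cnj ?C)"
    unfolding psi_def Let_def by (rule mult_four_block_mat) (use M N in auto)
  also have "\<dots> = psi (M * N)"
    unfolding psi_def Let_def
    by (intro cong_four_block_mat eq_matI; use M N in \<open>simp add: scalar_prod_def cpart_sum
        jpart_sum sum.distrib sum_subtractf sum_negf algebra_simps\<close>)
  finally show ?thesis by simp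
qed

lemma psi_minus:
  assumes "M \<in> carrier_mat p q" and "N \<in> carrier_mat p q"
  shows "psi (M - N) = psi M - psi N"
proof (rule eq_matI)
  fix i j assume "i < dim_row (psi M - psi N)" "j < dim_col (psi M - psi N)"
  then show "psi (M - N) $$ (i, j) = (psi M - psi N) $$ (i, j)"
    using assms by (simp add: psi_def Let_def)
qed (use assms in \<open>simp_all add: psi_def Let_def\<close>)

lemma psi_one: "psi (1\<^sub>m n) = 1\<^sub>m (2 * n)"
proof -
  have "map_mat cpart (1\<^sub>m n) = 1\<^sub>m n" "map_mat jpart (1\<^sub>m n) = 0\<^sub>m n n"
    "map_mat cnj (1\<^sub>m n) = 1\<^sub>m n" "- map_mat cnj (0\<^sub>m n n) = 0\<^sub>m n n"
    by (rule eq_matI; simp)+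
  then show ?thesis
    by (simp add: psi_def Let_def mult_2)
qed

section \<open>Complex constants as rational functions\<close>

lemma ratfun_const_simps:
  "ratfun_const 0 = 0" "ratfun_const 1 = 1"
  "ratfun_const (x + y) = ratfun_const x + ratfun_const y"
  "ratfun_const (x - y) = ratfun_const x - ratfun_const y"
  "ratfun_const (x * y) = ratfun_const x * ratfun_const y"
  by (simp_all add: ratfun_const_def to_fract_def Zero_fract_def One_fract_def pCons_one
      mult.commute)

lemma semiring_hom_ratfun_const: "semiring_hom ratfun_const"
  by unfold_locales (simp_all add: ratfun_const_simps)

lemmas const_mat_mult = semiring_hom.mat_hom_mult[OF semiring_hom_ratfun_const]
lemmas const_mat_one = semiring_hom.mat_hom_one[OF semiring_hom_ratfun_const]

lemma const_mat_minus:
  assumes "M \<in> carrier_mat p q" and "N \<in> carrier_mat p q"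
  shows "const_mat (M - N) = const_mat M - const_mat N"
  using assms by (intro eq_matI) (auto simp: ratfun_const_simps)

section \<open>Arcs\<close>

lemma swap_in_arcs: "e \<in> arcs E \<Longrightarrow> prod.swap e \<in> arcs E"
  by (auto simp: arcs_def insert_commute)

lemma conj_transpose_indexed_mat:
  "conj_transpose (indexed_mat xs ys f) = indexed_mat ys xs (\<lambda>y x. quat_conj (f x y))"
  by (auto simp: conj_transpose_def indexed_mat_def intro!: eq_matI)

lemma quat_conj_zero [simp]: "quat_conj 0 = 0"
  by (simp add: quat_conj_def quat_arith_defs)

lemma finite_arcs:
  assumes "finite_loop_graph V E"
  shows "finite (arcs E)"
proof (rule finite_subset)
  show "arcs E \<subseteq> V \<times> V"
    using assms by (fastforce simp: arcs_def finite_loop_graph_def doubleton_eq_iff)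
qed (use assms in \<open>simp add: finite_loop_graph_def\<close>)

text \<open>Arcs fixed by inversion and loop edges are both injective images of the set of vertices
  that carry a loop.\<close>

lemma card_loop_arcs: "card {e \<in> arcs E. prod.swap e = e} = card (loop_edges E)"
proof -
  have "{e \<in> arcs E. prod.swap e = e} = (\<lambda>u. (u, u)) ` {u. {u} \<in> E}"
    unfolding arcs_def image_def prod.swap_def by fastforce
  moreover have "loop_edges E = (\<lambda>u. {u}) ` {u. {u} \<in> E}"
    unfolding loop_edges_def by blast
  ultimately show ?thesis
    by (simp add: card_image inj_on_def)
qed

text \<open>The loop arcs are subtracted from the total given by \<open>card_arcs\<close>.\<close>

lemma card_nonloop_arcs:
  assumes "finite_loop_graph V E"
  shows "card {e \<in> arcs E. prod.swap e \<noteq> e} = 2 * card (nonloop_edges E)"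
proof -
  have "arcs E = {e \<in> arcs E. prod.swap e \<noteq> e} \<union> {e \<in> arcs E. prod.swap e = e}"
    by auto
  then have "card (arcs E) =
      card {e \<in> arcs E. prod.swap e \<noteq> e} + card {e \<in> arcs E. prod.swap e = e}"
    using finite_arcs[OF assms] by (subst card_Un_disjoint[symmetric]) (auto intro: arg_cong)
  then show ?thesis
    using card_arcs[OF assms] card_loop_arcs[of E] by simp
qed

section \<open>Products of the matrices of the weighted graph\<close>

context
  fixes E :: "'v set set" and es :: "('v \<times> 'v) list"
  assumes es: "distinct es" "set es = arcs E"
begin

lemma J0_mult_J0: "J0_mat es * J0_mat es = 1\<^sub>m (length es)"
  unfolding J0_mat_def mult_indexed_mat[OF es(1)] one_indexed_mat[OF es(1)]
proof (rule indexed_mat_cong)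
  fix e f assume "e \<in> set es" "f \<in> set es"
  \<comment> \<open>Closure under inversion puts the only index with a possibly nonzero term into
    the range of summation.\<close>
  then have "prod.swap e \<in> set es" using swap_in_arcs es(2) by metis
  then have "(\<Sum>y\<in>set es. (if y = prod.swap e then 1 else 0) * (if f = prod.swap y then 1 else 0)) =
      (if f = e then 1 else 0 :: quat)"
    by (subst sum.remove[of _ "prod.swap e"]) (auto intro: sum.neutral)
  then show "(\<Sum>y\<in>set es. (if y = prod.swap e then 1 else 0) * (if f = prod.swap y then 1 else 0)) =
      (if e = f then 1 else 0 :: quat)"
    by (simp add: eq_commute)
qed

text \<open>An arc contributes to the entry at \<open>u\<close>, \<open>v\<close> only if it ends at
  \<open>u\<close> and starts at \<open>v\<close>. In a graph without multiple edges this can only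
  be \<open>(v, u)\<close>, so no sum remains.\<close>

lemma L_mult_K: "conj_transpose (L_mat es vs b) * K_mat es vs a = W_mat E vs a b"
  unfolding L_mat_def K_mat_def W_mat_def conj_transpose_indexed_mat mult_indexed_mat[OF es(1)]
proof (rule indexed_mat_cong)
  fix u v
  let ?g = "\<lambda>e. quat_conj (if snd e = u then b e else 0) * (if fst e = v then a e else 0)"
  have "sum ?g (set es) = sum ?g (set es \<inter> {(v, u)})"
    by (rule sum.mono_neutral_right) auto
  also have "\<dots> = (if (v, u) \<in> arcs E then quat_conj (b (v, u)) * a (v, u) else 0)"
    using es(2) by auto
  finally show "sum ?g (set es) = \<dots>" .
qed

text \<open>Left multiplication by \<open>J0_mat es\<close> replaces the row of each arc by that of
  its inverse, whose origin is the terminus of the arc.\<close>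

lemma J0_mult_K:
  "J0_mat es * K_mat es vs a =
    indexed_mat es vs (\<lambda>e v. if snd e = v then a (prod.swap e) else 0)"
  unfolding J0_mat_def K_mat_def mult_indexed_mat[OF es(1)]
proof (rule indexed_mat_cong)
  fix e v assume "e \<in> set es"
  then have "prod.swap e \<in> set es" using swap_in_arcs es(2) by metis
  then show "(\<Sum>y\<in>set es. (if y = prod.swap e then 1 else 0) * (if fst y = v then a y else 0)) =
      (if snd e = v then a (prod.swap e) else 0)"
    by (subst sum.remove[of _ "prod.swap e"]) (auto intro: sum.neutral)
qed

text \<open>Both factors now test the terminus of the same arc, which forces \<open>u = v\<close>
  and makes the product diagonal.\<close>

lemma L_mult_J0_mult_K:
  "conj_transpose (L_mat es vs b) * (J0_mat es * K_mat es vs a) = D_mat E vs a b"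
  unfolding J0_mult_K L_mat_def D_mat_def conj_transpose_indexed_mat mult_indexed_mat[OF es(1)]
proof (rule indexed_mat_cong)
  fix u v
  let ?g = "\<lambda>e. quat_conj (if snd e = u then b e else 0) *
    (if snd e = v then a (prod.swap e) else 0)"
  let ?h = "\<lambda>e. quat_conj (b (prod.swap e)) * a e"
  have "sum ?g (set es) =
      (\<Sum>e\<in>set es. if snd e = u then if u = v then ?h (prod.swap e) else 0 else 0)"
    by (intro sum.cong) auto
  also have "\<dots> = (if u = v then sum (\<lambda>e. ?h (prod.swap e)) {e \<in> arcs E. snd e = u} else 0)"
    unfolding es(2)[symmetric] by (subst sum.inter_filter[symmetric]) auto
  \<comment> \<open>Inversion exchanges the arcs ending at \<open>u\<close> with those starting at
    \<open>u\<close>, over which \<open>D_mat\<close> sums.\<close>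
  also have "sum (\<lambda>e. ?h (prod.swap e)) {e \<in> arcs E. snd e = u} = sum ?h {e \<in> arcs E. fst e = u}"
    by (rule sum.reindex_bij_witness[of _ prod.swap prod.swap]) (auto dest: swap_in_arcs)
  finally show "sum ?g (set es) = (if u = v then \<dots> else 0)" .
qed

text \<open>The entries of \<open>J0_mat es\<close> are 0 and 1, so its \<open>jpart\<close>
  vanishes and conjugation fixes its \<open>cpart\<close>; this makes \<open>psi\<close> block
  diagonal with equal blocks. The two equal blocks double both exponents.\<close>

lemma det_one_plus_psi_J0:
  assumes "finite_loop_graph V E"
  shows "det (1\<^sub>m (2 * length es) + t \<cdot>\<^sub>m const_mat (psi (J0_mat es))) =
    (1 - t\<^sup>2) ^ (2 * card (nonloop_edges E)) * (1 + t) ^ (2 * card (loop_edges E))"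
proof -
  let ?m = "length es"
  let ?S = "indexed_mat es es
    (\<lambda>e f. (if e = f then 1 else 0) + (if f = prod.swap e then t else 0))"
  let ?C = "indexed_mat es es (\<lambda>e f. if f = prod.swap e then 1 else 0) :: complex mat"
  let ?R = "indexed_mat es es (\<lambda>e f. if f = prod.swap e then 1 else 0) :: ratfun mat"
  let ?O = "0\<^sub>m ?m ?m"
  have "map_mat cpart (J0_mat es) = ?C" "map_mat cnj ?C = ?C"
    unfolding J0_mat_def map_indexed_mat by (rule indexed_mat_cong, simp)+
  moreover have "map_mat jpart (J0_mat es) = ?O"
    unfolding J0_mat_def indexed_mat_def by (rule eq_matI) simp_all
  moreover have "- map_mat cnj ?O = ?O"
    by (rule eq_matI) simp_all
  ultimately have "psi (J0_mat es) = four_block_mat ?C ?O ?O ?C"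
    unfolding psi_def Let_def by simp
  then have "const_mat (psi (J0_mat es)) =
      four_block_mat (const_mat ?C) (const_mat ?O) (const_mat ?O) (const_mat ?C)"
    by (simp only:)
      (rule map_four_block_mat[OF indexed_mat_carrier zero_carrier_mat zero_carrier_mat
          indexed_mat_carrier])
  also have "const_mat ?C = ?R"
    unfolding map_indexed_mat by (rule indexed_mat_cong) (simp add: ratfun_const_simps)
  also have "const_mat ?O = ?O"
    by (rule eq_matI) (simp_all add: ratfun_const_simps)
  finally have "t \<cdot>\<^sub>m const_mat (psi (J0_mat es)) =
      four_block_mat (t \<cdot>\<^sub>m ?R) (t \<cdot>\<^sub>m ?O) (t \<cdot>\<^sub>m ?O) (t \<cdot>\<^sub>m ?R)"
    by (simp only:)
      (rule smult_four_block_mat[OF indexed_mat_carrier zero_carrier_mat zero_carrier_mat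
          indexed_mat_carrier])
  also have "t \<cdot>\<^sub>m ?O = ?O"
    by (rule eq_matI) simp_all
  finally have "1\<^sub>m (2 * ?m) + t \<cdot>\<^sub>m const_mat (psi (J0_mat es)) =
      four_block_mat (1\<^sub>m ?m) ?O ?O (1\<^sub>m ?m) + four_block_mat (t \<cdot>\<^sub>m ?R) ?O ?O (t \<cdot>\<^sub>m ?R)"
    by (simp only: four_block_one_mat mult_2)
  also have "\<dots> = four_block_mat (1\<^sub>m ?m + t \<cdot>\<^sub>m ?R) (?O + ?O) (?O + ?O) (1\<^sub>m ?m + t \<cdot>\<^sub>m ?R)"
    by (rule add_four_block_mat[of _ ?m ?m _ ?m _ ?m]) simp_all
  also have "1\<^sub>m ?m + t \<cdot>\<^sub>m ?R = ?S"
    unfolding one_indexed_mat[OF es(1)] indexed_mat_def by (rule eq_matI) simp_all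
  also have "?O + ?O = (?O :: ratfun mat)"
    by simp
  finally have "1\<^sub>m (2 * ?m) + t \<cdot>\<^sub>m const_mat (psi (J0_mat es)) =
      four_block_mat ?S ?O ?O ?S" .
  then have "det (1\<^sub>m (2 * ?m) + t \<cdot>\<^sub>m const_mat (psi (J0_mat es))) = det ?S * det ?S"
    using det_four_block_mat_lower_left_zero[OF indexed_mat_carrier zero_carrier_mat refl
        indexed_mat_carrier] by simp
  \<comment> \<open>The fixed points of inversion are the loop arcs. The other arcs number twice the
    non-loop edges, which the halved exponent turns into the number of these edges.\<close>
  also have "det ?S =
      (1 - t\<^sup>2) ^ card (nonloop_edges E) * (1 + t) ^ card (loop_edges E)"
    using det_one_plus_involution[OF es(1), of prod.swap t] es(2) swap_in_arcs[of _ E]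
      card_nonloop_arcs[OF assms] card_loop_arcs[of E]
    by simp
  also have "\<dots> * \<dots> =
      (1 - t\<^sup>2) ^ (2 * card (nonloop_edges E)) * (1 + t) ^ (2 * card (loop_edges E))"
    unfolding mult_2 power_add by (simp only: mult_ac)
  finally show ?thesis .
qed

end

section \<open>Assembly over the field of rational functions\<close>

lemma ratfun_var_power2_neq_1: "1 - ratfun_var\<^sup>2 \<noteq> 0"
proof
  assume "1 - ratfun_var\<^sup>2 = 0"
  \<comment> \<open>The embedding of polynomials is injective, so the nonzero polynomial with these
    coefficients cannot be mapped to 0.\<close>
  then have "to_fract [:1, 0, -1 :: complex:] = 0"
    by (simp add: ratfun_var_def power2_eq_square to_fract_def One_fract_def one_pCons)
  then show False by simp
qed

theorem theorem4p2:
  fixes V :: "'v set" and E :: "'v set set"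
    and a b :: "'v \<times> 'v \<Rightarrow> quat"
    and vs :: "'v list" and es :: "('v \<times> 'v) list"
    and n m0 m1 m' :: nat
    and t :: ratfun
  assumes "finite_loop_graph V E"
    and "distinct vs" and "set vs = V"
    and "distinct es" and "set es = arcs E"
    and "n = card V"
    and "m0 = card (nonloop_edges E)"
    and "m1 = card (loop_edges E)"
    and "m' = 2 * m0 + m1"
    and "t = ratfun_var"
  shows "det (1\<^sub>m (2 * m') -
        t \<cdot>\<^sub>m const_mat (psi (K_mat es vs a * conj_transpose (L_mat es vs b) - J0_mat es)))
    = (1 - t ^ 2) powi (2 * int m0 - 2 * int n) * (1 + t) ^ (2 * m1) *
      det (1\<^sub>m (2 * n) - t \<cdot>\<^sub>m const_mat (psi (W_mat E vs a b))
        + t ^ 2 \<cdot>\<^sub>m (const_mat (psi (D_mat E vs a b)) - 1\<^sub>m (2 * n)))"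
proof -
  let ?L = "conj_transpose (L_mat es vs b)" and ?K = "K_mat es vs a" and ?J = "J0_mat es"
  let ?P = "\<lambda>M. const_mat (psi M)"
  have n: "length vs = n"
    using assms distinct_card[of vs] by simp
  have m': "length es = m'"
    using assms distinct_card[of es] card_arcs[OF assms(1)] by simp
  have K: "?K \<in> carrier_mat m' n" and L: "?L \<in> carrier_mat n m'" and J: "?J \<in> carrier_mat m' m'"
    using n m' indexed_mat_carrier
    by (auto simp: K_mat_def L_mat_def J0_mat_def conj_transpose_indexed_mat)
  note psi_carr = psi_carrier[OF K] psi_carrier[OF L] psi_carrier[OF J]
  have P_mult: "?P (M * N) = ?P M * ?P N"
    if "M \<in> carrier_mat p q" "N \<in> carrier_mat q r" for M N p q r
    using that psi_mult const_mat_mult[OF psi_carrier psi_carrier] by metis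
  have KL: "?P (?K * ?L - ?J) = ?P ?K * ?P ?L - ?P ?J"
    using psi_minus[OF mult_carrier_mat[OF K L] J] P_mult[OF K L]
      const_mat_minus[OF psi_carrier[OF mult_carrier_mat[OF K L]] psi_carrier[OF J]] by simp
  have W: "?P ?L * ?P ?K = ?P (W_mat E vs a b)"
    using P_mult[OF L K] L_mult_K[OF assms(4,5)] by metis
  have D: "?P ?L * (?P ?J * ?P ?K) = ?P (D_mat E vs a b)"
    using P_mult[OF L mult_carrier_mat[OF J K]] P_mult[OF J K] L_mult_J0_mult_K[OF assms(4,5)]
    by metis
  have JJ: "?P ?J * ?P ?J = 1\<^sub>m (2 * m')"
    using P_mult[OF J J] J0_mult_J0[OF assms(4,5)] psi_one const_mat_one m' by metis
  let ?l = "det (1\<^sub>m (2 * m') - t \<cdot>\<^sub>m ?P (?K * ?L - ?J))"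
  let ?d = "det (1\<^sub>m (2 * n) - t \<cdot>\<^sub>m ?P (W_mat E vs a b)
        + t\<^sup>2 \<cdot>\<^sub>m (?P (D_mat E vs a b) - 1\<^sub>m (2 * n)))"
  \<comment> \<open>The exchange lemma is applied with \<open>?P ?K\<close>, \<open>?P ?L\<close>
    and \<open>?P ?J\<close> for \<open>A\<close>, \<open>B\<close> and \<open>N\<close>. Since
    \<open>psi\<close> doubles dimensions, the sizes are \<open>2 * m'\<close> and
    \<open>2 * n\<close>, and the latter is the exponent.\<close>
  have "?l * (1 - t\<^sup>2) ^ (2 * n) = det (1\<^sub>m (2 * m') + t \<cdot>\<^sub>m ?P ?J) * ?d"
    unfolding KL W[symmetric] D[symmetric]
    by (rule det_one_minus_mult_involution) (use psi_carr JJ in auto)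
  also have "det (1\<^sub>m (2 * m') + t \<cdot>\<^sub>m ?P ?J) = (1 - t\<^sup>2) ^ (2 * m0) * (1 + t) ^ (2 * m1)"
    using det_one_plus_psi_J0[OF assms(4,5,1)] m' assms(7,8) by simp
  finally have eq: "?l * (1 - t\<^sup>2) ^ (2 * n) = (1 - t\<^sup>2) ^ (2 * m0) * (1 + t) ^ (2 * m1) * ?d" .
  have t: "1 - t\<^sup>2 \<noteq> 0"
    using ratfun_var_power2_neq_1 assms(10) by simp
  \<comment> \<open>The exponent is negative when there are fewer non-loop edges than vertices. As
    the base is nonzero, the integer power is a quotient of two natural powers.\<close>
  have "(1 - t\<^sup>2) powi (2 * int m0 - 2 * int n) =
      (1 - t\<^sup>2) powi int (2 * m0) / (1 - t\<^sup>2) powi int (2 * n)"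
    using power_int_diff[of "1 - t\<^sup>2" "2 * int m0" "2 * int n"] t by simp
  also have "\<dots> = (1 - t\<^sup>2) ^ (2 * m0) / (1 - t\<^sup>2) ^ (2 * n)"
    by (simp only: power_int_of_nat)
  finally have powi: "(1 - t\<^sup>2) powi (2 * int m0 - 2 * int n) = \<dots>" .
  have "?l = (1 - t\<^sup>2) ^ (2 * m0) * (1 + t) ^ (2 * m1) * ?d / (1 - t\<^sup>2) ^ (2 * n)"
    using eq t by (simp add: nonzero_eq_divide_eq)
  then show ?thesis
    unfolding powi by simp
qed

end
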